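(* Let $n\ge 2$. Let $\mu:\mathcal{C}(\mathbb{R}^n)\to\mathbb{R}$ be a continuous $\operatorname{O}(n)$-invariant valuation such that $\mu(C)=0$ for every $C\in\mathcal{C}(\mathbb{R}^n)$ which satisfies $\dim C<n$ or which contains a line. Then $\mu(C)=0$ for every pointed simplicial cone $C\subseteq\mathbb{R}^n$.
   Context: A closed convex cone in $\mathbb{R}^n$ is a nonempty closed convex set $C\subseteq\mathbb{R}^n$ with $tC=C$ for every $t>0$; $\mathcal{C}(\mathbb{R}^n)$ is the set of all of them. The dimension of a cone is the dimension of its linear span. A cone is simplicial if it is the set of nonnegative linear combinations of a finite linearly independent list of vectors (the empty list generates $\{0\}$), and pointed if $C\cap(-C)=\{0\}$. "Line" means a one-dimensional linear subspace. Topology on $\mathcal{C}(\mathbb{R}^n)$: for nonzero cones $C,D$ the distance is the Hausdorff distance between $C\cap\mathbb{S}^{n-1}$ and $D\cap\mathbb{S}^{n-1}$ with respect to the spherical (angular) distance; the cone $\{0\}$ is an isolated point. Continuity refers to this topology. A real valuation on $\mathcal{C}(\mathbb{R}^n)$ is a map $\mu:\mathcal{C}(\mathbb{R}^n)\to\mathbb{R}$ with $\mu(C\cup D)+\mu(C\cap D)=\mu(C)+\mu(D)$ whenever $C$, $D$ and $C\cup D$ are in $\mathcal{C}(\mathbb{R}^n)$. It is $\operatorname{O}(n)$-invariant if $\mu(gC)=\mu(C)$ for all $g\in\operatorname{O}(n)$ and all $C$. *)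

theory Defs
  imports "HOL-Analysis.Analysis"
begin

definition closed_convex_cones :: "'a::euclidean_space set set" where
  "closed_convex_cones =
     {C. C \<noteq> {} \<and> closed C \<and> convex C \<and> (\<forall>t>0. (\<lambda>x. t *\<^sub>R x) ` C = C)}"

lemma closed_convex_cones_iff:
  "C \<in> closed_convex_cones \<longleftrightarrow> closed C \<and> convex_cone C"
proof
  assume C: "C \<in> closed_convex_cones"
  then have ne: "C \<noteq> {}" and cl: "closed C" and cv: "convex C"
    and sc: "\<And>t. t > 0 \<Longrightarrow> (\<lambda>x. t *\<^sub>R x) ` C = C"
    by (auto simp: closed_convex_cones_def)
  obtain x where x: "x \<in> C" using ne by blast
  have "(\<lambda>k. (1 / real (Suc k)) *\<^sub>R x) \<longlonglongrightarrow> 0 *\<^sub>R x"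
    by (intro tendsto_intros LIMSEQ_Suc lim_1_over_n)
  moreover have "(1 / real (Suc k)) *\<^sub>R x \<in> C" for k
    using sc[of "1 / real (Suc k)"] x by (metis imageI of_nat_0_less_iff zero_less_Suc zero_less_divide_1_iff)
  ultimately have 0: "0 \<in> C"
    using cl closed_sequentially by (metis (no_types, lifting) scaleR_zero_left)
  have "c *\<^sub>R y \<in> C" if "y \<in> C" "0 \<le> c" for y c
    using sc[of c] that 0 by (cases "c = 0") auto
  then show "closed C \<and> convex_cone C"
    using ne cl cv by (auto simp: convex_cone_def conic_def)
next
  assume C: "closed C \<and> convex_cone C"
  then have cone: "cone C" and ne: "C \<noteq> {}" and cv: "convex C"
    by (auto simp: convex_cone_def conic_def cone_def)
  then have "\<forall>t>0. (\<lambda>x. t *\<^sub>R x) ` C = C"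
    using cone_iff[OF ne] by simp
  then show "C \<in> closed_convex_cones"
    using C ne cv by (auto simp: closed_convex_cones_def)
qed

definition simplicial_cone :: "'a::euclidean_space set \<Rightarrow> bool" where
  "simplicial_cone C \<longleftrightarrow>
     (\<exists>B. finite B \<and> independent B \<and>
          C = {(\<Sum>b\<in>B. c b *\<^sub>R b) | c. \<forall>b\<in>B. (0::real) \<le> c b})"

definition pointed_cone :: "'a::euclidean_space set \<Rightarrow> bool" where
  "pointed_cone C \<longleftrightarrow> C \<inter> uminus ` C = {0}"

definition contains_line :: "'a::euclidean_space set \<Rightarrow> bool" where
  "contains_line C \<longleftrightarrow> (\<exists>L. subspace L \<and> dim L = 1 \<and> L \<subseteq> C)"

definition hausdorff_distance :: "('a \<Rightarrow> 'a \<Rightarrow> real) \<Rightarrow> 'a set \<Rightarrow> 'a set \<Rightarrow> real" where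
  "hausdorff_distance d A B =
     max (SUP x\<in>A. INF y\<in>B. d x y) (SUP y\<in>B. INF x\<in>A. d x y)"

text \<open>The angular distance; only used for unit vectors.\<close>

definition spherical_dist :: "'a::euclidean_space \<Rightarrow> 'a \<Rightarrow> real" where
  "spherical_dist x y = arccos (x \<bullet> y)"

text \<open>The zero cone misses the unit sphere and is to be an isolated point, so it is put at a
  positive distance from all other cones. The value \<^term>\<open>pi\<close> bounds all distances between
  nonzero cones, so that the triangle inequality holds; any such constant gives the same topology.
  Off the cones the value is irrelevant; it is \<^term>\<open>0::real\<close> because \<^locale>\<open>Metric_space\<close> asks for
  nonnegativity everywhere.\<close>

definition cone_dist :: "'a::euclidean_space set \<Rightarrow> 'a set \<Rightarrow> real" where
  "cone_dist C D =
     (if C \<notin> closed_convex_cones \<or> D \<notin> closed_convex_cones then 0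
      else if C = {0} \<or> D = {0} then (if C = D then 0 else pi)
      else hausdorff_distance spherical_dist (C \<inter> sphere 0 1) (D \<inter> sphere 0 1))"

definition cone_topology :: "'a::euclidean_space set topology" where
  "cone_topology = Metric_space.mtopology closed_convex_cones cone_dist"

definition cone_valuation :: "('a::euclidean_space set \<Rightarrow> real) \<Rightarrow> bool" where
  "cone_valuation \<mu> \<longleftrightarrow>
     (\<forall>C D. C \<in> closed_convex_cones \<and> D \<in> closed_convex_cones \<and> C \<union> D \<in> closed_convex_cones
        \<longrightarrow> \<mu> (C \<union> D) + \<mu> (C \<inter> D) = \<mu> C + \<mu> D)"

definition orthogonally_invariant :: "('a::euclidean_space set \<Rightarrow> real) \<Rightarrow> bool" where
  "orthogonally_invariant \<mu> \<longleftrightarrow>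
     (\<forall>g. orthogonal_transformation g \<longrightarrow> (\<forall>C\<in>closed_convex_cones. \<mu> (g ` C) = \<mu> C))"


subsection \<open>The distance on cones is a metric\<close>

lemma spherical_dist_bounds:
  assumes "norm x = 1" "norm y = 1"
  shows "0 \<le> spherical_dist x y" "spherical_dist x y \<le> pi"
proof -
  have "\<bar>x \<bullet> y\<bar> \<le> 1" using Cauchy_Schwarz_ineq2[of x y] assms by simp
  then show "0 \<le> spherical_dist x y" "spherical_dist x y \<le> pi"
    by (auto simp: spherical_dist_def abs_le_iff intro!: arccos_lbound arccos_ubound)
qed

lemma spherical_dist_commute: "spherical_dist x y = spherical_dist y x"
  by (simp add: spherical_dist_def inner_commute)

lemma spherical_dist_triangle:
  assumes n: "norm x = 1" "norm y = 1" "norm z = 1"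
  shows "spherical_dist x z \<le> spherical_dist x y + spherical_dist y z"
proof -
  let ?a = "x \<bullet> y" and ?b = "y \<bullet> z" and ?c = "x \<bullet> z"
  have in1: "x \<bullet> x = 1" "y \<bullet> y = 1" "z \<bullet> z = 1"
    using n by (simp_all add: dot_square_norm)
  have bd: "\<bar>?a\<bar> \<le> 1" "\<bar>?b\<bar> \<le> 1" "\<bar>?c\<bar> \<le> 1"
    using Cauchy_Schwarz_ineq2[of x y] Cauchy_Schwarz_ineq2[of y z] Cauchy_Schwarz_ineq2[of x z] n
    by simp_all
  have nx: "norm (x - ?a *\<^sub>R y) = sqrt (1 - ?a\<^sup>2)"
    by (simp add: norm_eq_sqrt_inner inner_diff inner_commute in1 power2_eq_square)
  have nz: "norm (z - ?b *\<^sub>R y) = sqrt (1 - ?b\<^sup>2)"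
    by (simp add: norm_eq_sqrt_inner inner_diff inner_commute in1 power2_eq_square)
  have "(x - ?a *\<^sub>R y) \<bullet> (z - ?b *\<^sub>R y) = ?c - ?a * ?b"
    by (simp add: inner_diff inner_commute in1)
  moreover have "\<bar>(x - ?a *\<^sub>R y) \<bullet> (z - ?b *\<^sub>R y)\<bar> \<le> sqrt (1 - ?a\<^sup>2) * sqrt (1 - ?b\<^sup>2)"
    using Cauchy_Schwarz_ineq2[of "x - ?a *\<^sub>R y" "z - ?b *\<^sub>R y"] by (simp only: nx nz)
  ultimately have le: "?a * ?b - sqrt (1 - ?a\<^sup>2) * sqrt (1 - ?b\<^sup>2) \<le> ?c"
    by linarith
  have cos: "cos (arccos ?a + arccos ?b) \<le> ?c"
    using le bd by (simp add: cos_add sin_arccos_abs cos_arccos_abs)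
  show ?thesis
  proof (cases "arccos ?a + arccos ?b \<le> pi")
    case True
    have ge: "0 \<le> arccos ?a + arccos ?b"
      using bd by (intro add_nonneg_nonneg arccos_lbound) (auto simp: abs_le_iff)
    have "arccos ?c \<le> arccos (cos (arccos ?a + arccos ?b))"
      using cos bd by (intro arccos_le_mono[THEN iffD2]) (auto simp: abs_le_iff)
    then show ?thesis
      using arccos_cos[OF ge True] by (simp add: spherical_dist_def)
  next
    case False
    then show ?thesis
      using spherical_dist_bounds(2)[OF n(1) n(3)] by (simp add: spherical_dist_def)
  qed
qed

lemma spherical_dist_eq_0:
  assumes "norm x = 1" "norm y = 1"
  shows "spherical_dist x y = 0 \<longleftrightarrow> x = y"
proof
  assume "spherical_dist x y = 0"
  moreover have "\<bar>x \<bullet> y\<bar> \<le> 1" using Cauchy_Schwarz_ineq2[of x y] assms by simp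
  ultimately have "x \<bullet> y = 1"
    using cos_arccos_abs[of "x \<bullet> y"] by (simp add: spherical_dist_def)
  then have "(x - y) \<bullet> (x - y) = 0"
    using assms by (simp add: inner_diff inner_commute norm_eq_1)
  then show "x = y" by simp
qed (use assms in \<open>simp add: spherical_dist_def dot_square_norm\<close>)


definition excess :: "('a \<Rightarrow> 'a \<Rightarrow> real) \<Rightarrow> 'a set \<Rightarrow> 'a set \<Rightarrow> real" where
  "excess d A B = (SUP x\<in>A. INF y\<in>B. d x y)"

lemma hausdorff_distance_excess:
  assumes "\<And>x y. d x y = d y x"
  shows "hausdorff_distance d A B = max (excess d A B) (excess d B A)"
  using assms by (simp add: hausdorff_distance_def excess_def)

lemma INF_spherical_bounds:
  assumes x: "x \<in> sphere 0 1" and B: "B \<subseteq> sphere 0 1" "B \<noteq> {}"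
  shows "bdd_below (spherical_dist x ` B)"
    and "0 \<le> (INF y\<in>B. spherical_dist x y)" and "(INF y\<in>B. spherical_dist x y) \<le> pi"
proof -
  show bb: "bdd_below (spherical_dist x ` B)"
    using x B by (intro bdd_belowI[of _ 0]) (auto intro!: spherical_dist_bounds)
  show "0 \<le> (INF y\<in>B. spherical_dist x y)"
    using x B by (intro cINF_greatest) (auto intro!: spherical_dist_bounds)
  obtain y where y: "y \<in> B" using B by blast
  then have "norm y = 1" "norm x = 1" using x B by auto
  then show "(INF y\<in>B. spherical_dist x y) \<le> pi"
    using cINF_lower[OF bb y] spherical_dist_bounds(2)[of x y] by linarith
qed

lemma excess_bounds:
  assumes A: "A \<subseteq> sphere 0 1" "A \<noteq> {}" and B: "B \<subseteq> sphere 0 1" "B \<noteq> {}"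
  shows "x \<in> A \<Longrightarrow> (INF y\<in>B. spherical_dist x y) \<le> excess spherical_dist A B"
    and "0 \<le> excess spherical_dist A B" and "excess spherical_dist A B \<le> pi"
proof -
  have ba: "bdd_above ((\<lambda>x. INF y\<in>B. spherical_dist x y) ` A)"
    using INF_spherical_bounds(3)[OF _ B] A by (intro bdd_aboveI[of _ pi]) auto
  show up: "(INF y\<in>B. spherical_dist x y) \<le> excess spherical_dist A B" if "x \<in> A" for x
    unfolding excess_def by (rule cSUP_upper[OF that ba])
  obtain x where x: "x \<in> A" using A by blast
  then have "x \<in> sphere 0 1" using A by blast
  then show "0 \<le> excess spherical_dist A B"
    using up[OF x] INF_spherical_bounds(2)[OF _ B, of x] by linarith
  show "excess spherical_dist A B \<le> pi"
    unfolding excess_def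
  proof (rule cSUP_least)
    show "A \<noteq> {}" by (rule A)
    show "(INF y\<in>B. spherical_dist x y) \<le> pi" if "x \<in> A" for x
      using that A INF_spherical_bounds(3)[OF _ B] by blast
  qed
qed

lemma excess_triangle:
  assumes A: "A \<subseteq> sphere 0 1" "A \<noteq> {}" and B: "B \<subseteq> sphere 0 1" "B \<noteq> {}"
    and C: "C \<subseteq> sphere 0 1" "C \<noteq> {}"
  shows "excess spherical_dist A C \<le> excess spherical_dist A B + excess spherical_dist B C"
proof -
  have "(INF z\<in>C. spherical_dist x z) \<le> excess spherical_dist A B + excess spherical_dist B C"
    if x: "x \<in> A" for x
  proof -
    have xs: "x \<in> sphere 0 1" using x A by blast
    have "(INF z\<in>C. spherical_dist x z) - excess spherical_dist B C \<le> spherical_dist x y"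
      if y: "y \<in> B" for y
    proof -
      have ys: "y \<in> sphere 0 1" using y B by blast
      have "(INF z\<in>C. spherical_dist x z) - spherical_dist x y \<le> spherical_dist y z"
        if z: "z \<in> C" for z
      proof -
        have "z \<in> sphere 0 1" using z C by blast
        then have "spherical_dist x z \<le> spherical_dist x y + spherical_dist y z"
          using xs ys by (intro spherical_dist_triangle) auto
        then show ?thesis
          using cINF_lower[OF INF_spherical_bounds(1)[OF xs C] z] by linarith
      qed
      then have "(INF z\<in>C. spherical_dist x z) - spherical_dist x y
                   \<le> (INF z\<in>C. spherical_dist y z)"
        by (intro cINF_greatest[OF C(2)])
      then show ?thesis
        using excess_bounds(1)[OF B C y] by linarith
    qed
    then have "(INF z\<in>C. spherical_dist x z) - excess spherical_dist B C
                 \<le> (INF y\<in>B. spherical_dist x y)"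
      by (intro cINF_greatest[OF B(2)])
    then show ?thesis
      using excess_bounds(1)[OF A B x] by linarith
  qed
  then show ?thesis
    unfolding excess_def[of _ A C] by (intro cSUP_least[OF A(2)])
qed

lemma excess_le_0_imp_subset:
  assumes A: "A \<subseteq> sphere 0 1" "A \<noteq> {}" and B: "B \<subseteq> sphere 0 1" "B \<noteq> {}" and "compact B"
    and le: "excess spherical_dist A B \<le> 0"
  shows "A \<subseteq> B"
proof
  fix x assume x: "x \<in> A"
  have xs: "norm x = 1" using x A by auto
  have "continuous_on B (\<lambda>y. arccos (x \<bullet> y))"
  proof (rule continuous_on_arccos)
    show "continuous_on B (\<lambda>y. x \<bullet> y)" by (intro continuous_intros)
    show "\<forall>y\<in>B. -1 \<le> x \<bullet> y \<and> x \<bullet> y \<le> 1"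
    proof
      fix y assume "y \<in> B"
      then have "norm y = 1" using B by auto
      then have "\<bar>x \<bullet> y\<bar> \<le> 1" using Cauchy_Schwarz_ineq2[of x y] xs by simp
      then show "-1 \<le> x \<bullet> y \<and> x \<bullet> y \<le> 1" by (auto simp: abs_le_iff)
    qed
  qed
  then obtain y where y: "y \<in> B" "\<forall>z\<in>B. spherical_dist x y \<le> spherical_dist x z"
    using continuous_attains_inf[OF \<open>compact B\<close> B(2)] unfolding spherical_dist_def by blast
  then have "spherical_dist x y \<le> (INF z\<in>B. spherical_dist x z)"
    by (intro cINF_greatest[OF B(2)]) auto
  also have "\<dots> \<le> 0" using excess_bounds(1)[OF A B x] le by linarith
  finally have "spherical_dist x y \<le> 0" .
  moreover have "norm y = 1" using y B by auto
  ultimately have "x = y"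
    using spherical_dist_bounds(1)[of x y] spherical_dist_eq_0[of x y] xs by simp
  then show "x \<in> B" using y by simp
qed

lemma excess_self:
  assumes A: "A \<subseteq> sphere 0 1" "A \<noteq> {}"
  shows "excess spherical_dist A A = 0"
proof -
  have "(INF y\<in>A. spherical_dist x y) \<le> 0" if x: "x \<in> A" for x
  proof -
    have xs: "x \<in> sphere 0 1" using x A by blast
    then have "spherical_dist x x = 0" by (simp add: spherical_dist_eq_0)
    then show ?thesis
      using cINF_lower[OF INF_spherical_bounds(1)[OF xs A] x] by simp
  qed
  then have "excess spherical_dist A A \<le> 0"
    unfolding excess_def by (intro cSUP_least[OF A(2)])
  then show ?thesis using excess_bounds(2)[OF A A] by linarith
qed

lemma closed_convex_cone_link:
  assumes C: "C \<in> closed_convex_cones" and "C \<noteq> {0}"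
  shows "C \<inter> sphere 0 1 \<noteq> {}" and "compact (C \<inter> sphere 0 1)"
proof -
  have cc: "closed C" "convex_cone C" using C by (auto simp: closed_convex_cones_iff)
  then have "0 \<in> C" using convex_cone_iff by blast
  then obtain x where x: "x \<in> C" "x \<noteq> 0" using assms by blast
  then have "(1 / norm x) *\<^sub>R x \<in> C \<inter> sphere 0 1"
    using convex_cone_scaleR[OF cc(2)] by simp
  then show "C \<inter> sphere 0 1 \<noteq> {}" by blast
  show "compact (C \<inter> sphere 0 1)" using cc by (simp add: closed_Int_compact)
qed

lemma closed_convex_cone_subset_by_link:
  assumes C: "C \<in> closed_convex_cones" and D: "D \<in> closed_convex_cones"
    and sub: "C \<inter> sphere 0 1 \<subseteq> D \<inter> sphere 0 1"
  shows "C \<subseteq> D"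
proof
  fix x assume x: "x \<in> C"
  have cc: "convex_cone C" "convex_cone D" using C D by (auto simp: closed_convex_cones_iff)
  show "x \<in> D"
  proof (cases "x = 0")
    case True
    then show ?thesis using cc convex_cone_iff by blast
  next
    case False
    then have "(1 / norm x) *\<^sub>R x \<in> C \<inter> sphere 0 1"
      using convex_cone_scaleR[OF cc(1)] x by simp
    then have "(1 / norm x) *\<^sub>R x \<in> D" using sub by blast
    then have "norm x *\<^sub>R ((1 / norm x) *\<^sub>R x) \<in> D"
      using convex_cone_scaleR[OF cc(2)] by (metis norm_ge_zero)
    then show ?thesis using False by simp
  qed
qed

lemma Metric_space_closed_convex_cones:
  "Metric_space closed_convex_cones (cone_dist :: 'a::euclidean_space set \<Rightarrow> _)"
proof
  fix C D E :: "'a set"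
  let ?S = "\<lambda>C. C \<inter> sphere (0::'a) 1"
  let ?H = "hausdorff_distance spherical_dist"
  note H = hausdorff_distance_excess[of spherical_dist, OF spherical_dist_commute]
  note link = closed_convex_cone_link(1)
  have bnd: "0 \<le> ?H (?S C) (?S D) \<and> ?H (?S C) (?S D) \<le> pi"
    if "C \<in> closed_convex_cones" "D \<in> closed_convex_cones" "C \<noteq> {0}" "D \<noteq> {0}" for C D
    using excess_bounds(2,3)[of "?S C" "?S D"] excess_bounds(2,3)[of "?S D" "?S C"]
      link[of C] link[of D] that by (simp add: H)
  show comm: "cone_dist C D = cone_dist D C"
    by (auto simp: cone_dist_def H max.commute)
  show "0 \<le> cone_dist C D"
    using bnd[of C D] by (auto simp: cone_dist_def)
  show "(cone_dist C D = 0) = (C = D)"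
    if C: "C \<in> closed_convex_cones" and D: "D \<in> closed_convex_cones"
  proof (cases "C = {0} \<or> D = {0}")
    case True
    then show ?thesis using C D by (auto simp: cone_dist_def)
  next
    case False
    then have ne: "?S C \<noteq> {}" "?S D \<noteq> {}" using link C D by blast+
    have comp: "compact (?S C)" "compact (?S D)"
      using closed_convex_cone_link(2) C D False by blast+
    have eq: "cone_dist C D = ?H (?S C) (?S D)" using False C D by (simp add: cone_dist_def)
    show ?thesis
    proof
      assume "C = D"
      then show "cone_dist C D = 0" using eq ne by (simp add: H excess_self)
    next
      assume "cone_dist C D = 0"
      then have "excess spherical_dist (?S C) (?S D) \<le> 0" "excess spherical_dist (?S D) (?S C) \<le> 0"
        using eq H[of "?S C" "?S D"] by linarith+
      then have "?S C \<subseteq> ?S D" "?S D \<subseteq> ?S C"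
        using ne comp by (auto dest!: excess_le_0_imp_subset[rotated -1])
      then show "C = D"
        using closed_convex_cone_subset_by_link[OF C D] closed_convex_cone_subset_by_link[OF D C]
        by blast
    qed
  qed
  show "cone_dist C E \<le> cone_dist C D + cone_dist D E"
    if C: "C \<in> closed_convex_cones" and D: "D \<in> closed_convex_cones"
      and E: "E \<in> closed_convex_cones"
  proof (cases "C = {0} \<or> D = {0} \<or> E = {0}")
    case True
    then show ?thesis
      using bnd[OF C E] bnd[OF C D] bnd[OF D E] C D E pi_gt_zero
      by (smt (verit) cone_dist_def)
  next
    case False
    then have ne: "?S C \<noteq> {}" "?S D \<noteq> {}" "?S E \<noteq> {}" using link C D E by blast+
    show ?thesis
      using False C D E excess_triangle[of "?S C" "?S D" "?S E"] excess_triangle[of "?S E" "?S D" "?S C"] ne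
      by (auto simp: cone_dist_def H)
  qed
qed

end

theory Submission
  imports Defs
begin

text \<open>For a matrix \<open>v\<close> with rows \<open>v\<^sub>1, \<dots>, v\<^sub>n\<close>, let \<open>F(v)\<close> be the sign of \<open>det v\<close> times \<open>\<mu>\<close> of the cone
  generated by the rows. Since \<open>\<mu>\<close> kills cones that contain a line, replacing a generator by its
  negative changes the sign of \<open>\<mu>\<close>, so \<open>F\<close> only depends on the lines spanned by the rows. As signs
  can be chosen freely, \<open>F\<close> is continuous even at degenerate matrices without zero rows, and
  subdividing gives \<open>F(v) = \<Sum>\<^sub>i F(v with row i replaced by x)\<close> for almost every \<open>x\<close>. Average this over \<open>x\<close> in
  a spherical shell: the reflection in the hyperplane spanned by the rows other than the \<open>i\<close>-th one
  changes the sign of the \<open>i\<close>-th summand, so every summand has mean zero.\<close>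

section \<open>Lebesgue measure under orthogonal maps\<close>

lemma nn_integral_lborel_affine_sign:
  fixes f :: "'a::euclidean_space \<Rightarrow> ennreal"
  assumes [measurable]: "f \<in> borel_measurable borel" and c: "\<bar>c\<bar> = 1"
  shows "(\<integral>\<^sup>+y. f (t + c *\<^sub>R y) \<partial>lborel) = (\<integral>\<^sup>+y. f y \<partial>lborel)"
proof -
  have "c \<noteq> 0" using c by auto
  then have "(\<integral>\<^sup>+y. f y \<partial>lborel)
      = (\<integral>\<^sup>+y. f y \<partial>density (distr lborel borel (\<lambda>x. t + c *\<^sub>R x)) (\<lambda>_. \<bar>c\<bar>^DIM('a)))"
    by (subst lborel_affine[of c t]) auto
  also have "\<dots> = (\<integral>\<^sup>+y. f (t + c *\<^sub>R y) \<partial>lborel)"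
    using c by (simp add: nn_integral_density nn_integral_distr)
  finally show ?thesis by simp
qed

text \<open>The argument behind uniqueness of Haar measure. Let \<open>g\<close> be the indicator of
  the unit ball, which \<open>R\<close> preserves. Translations and point reflections turn the
  double integral of \<open>g (R x) * h y\<close> into that of \<open>g y * h (R x)\<close>;
  cancelling the finite positive volume of the ball leaves equal integrals of \<open>h\<close> and
  of \<open>h\<close> after \<open>R\<close>.\<close>

lemma distr_lborel_orthogonal:
  fixes R :: "'a::euclidean_space \<Rightarrow> 'a"
  assumes R: "orthogonal_transformation R"
  shows "distr lborel borel R = lborel"
proof (rule measure_eqI)
  fix B assume "B \<in> sets (distr lborel borel R)"
  then have B [measurable]: "B \<in> sets borel" by simp
  have lin: "linear R" using R by (rule orthogonal_transformation_linear)
  have [measurable]: "R \<in> borel_measurable borel"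
    using lin by (intro borel_measurable_continuous_onI linear_continuous_on) (simp add: linear_conv_bounded_linear)
  define g :: "'a \<Rightarrow> ennreal" where "g = indicator (ball 0 1)"
  define h :: "'a \<Rightarrow> ennreal" where "h = indicator B"
  have [measurable]: "g \<in> borel_measurable borel" "h \<in> borel_measurable borel"
    unfolding g_def h_def by (auto intro!: borel_measurable_indicator B)
  have gR: "g (R x) = g x" for x
    using orthogonal_transformation_norm[OF R, of x] by (auto simp: g_def indicator_def)
  obtain R' where R': "\<And>y. R (R' y) = y"
    using orthogonal_transformation_surj[OF R] by (metis surj_def)
  have "(\<integral>\<^sup>+x. \<integral>\<^sup>+y. g (R x) * h y \<partial>lborel \<partial>lborel)
      = (\<integral>\<^sup>+x. \<integral>\<^sup>+y. g (R x) * h (R x + y) \<partial>lborel \<partial>lborel)"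
    using nn_integral_lborel_affine_sign[of h 1] by (simp add: nn_integral_cmult)
  also have "\<dots> = (\<integral>\<^sup>+y. \<integral>\<^sup>+x. g (R x) * h (R x + y) \<partial>lborel \<partial>lborel)"
    by (subst lborel_pair.Fubini') auto
  also have "\<dots> = (\<integral>\<^sup>+y. \<integral>\<^sup>+x. g (R x - y) * h (R x) \<partial>lborel \<partial>lborel)"
  proof (rule nn_integral_cong)
    fix y :: 'a
    show "(\<integral>\<^sup>+x. g (R x) * h (R x + y) \<partial>lborel) = (\<integral>\<^sup>+x. g (R x - y) * h (R x) \<partial>lborel)"
      \<comment> \<open>Replaces \<open>x\<close> by \<open>R' y + x\<close> in the right-hand
        integral; \<open>R\<close> maps this point to \<open>y + R x\<close>.\<close>
      using nn_integral_lborel_affine_sign[of "\<lambda>x. g (R x - y) * h (R x)" 1 "R' y"]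
      by (simp add: linear_add[OF lin] R' add.commute)
  qed
  also have "\<dots> = (\<integral>\<^sup>+x. \<integral>\<^sup>+y. g (R x - y) * h (R x) \<partial>lborel \<partial>lborel)"
    by (subst lborel_pair.Fubini') auto
  also have "\<dots> = (\<integral>\<^sup>+x. \<integral>\<^sup>+y. g y * h (R x) \<partial>lborel \<partial>lborel)"
  proof (rule nn_integral_cong)
    fix x :: 'a
    show "(\<integral>\<^sup>+y. g (R x - y) * h (R x) \<partial>lborel) = (\<integral>\<^sup>+y. g y * h (R x) \<partial>lborel)"
      \<comment> \<open>Substitutes \<open>R x - y\<close> for \<open>y\<close>, a point reflection
        followed by a translation.\<close>
      using nn_integral_lborel_affine_sign[of g "-1" "R x"] by (simp add: nn_integral_multc)
  qed
  finally have eq: "(\<integral>\<^sup>+x. g x \<partial>lborel) * (\<integral>\<^sup>+x. h x \<partial>lborel)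
      = (\<integral>\<^sup>+x. g x \<partial>lborel) * (\<integral>\<^sup>+x. h (R x) \<partial>lborel)"
    by (simp add: nn_integral_cmult nn_integral_multc gR)
  have "(\<integral>\<^sup>+x. g x \<partial>lborel) = emeasure lborel (ball (0::'a) 1)"
    by (simp add: g_def)
  moreover have "emeasure lborel (ball (0::'a) 1) \<noteq> 0"
    using content_ball_pos[of 1 "0::'a"] by (auto simp: measure_def)
  moreover have "emeasure lborel (ball (0::'a) 1) \<noteq> \<infinity>"
    using emeasure_bounded_finite[of "ball (0::'a) 1"] by simp
  ultimately have "(\<integral>\<^sup>+x. h x \<partial>lborel) = (\<integral>\<^sup>+x. h (R x) \<partial>lborel)"
    using eq by (auto simp: ennreal_mult_cancel_left)
  then show "emeasure (distr lborel borel R) B = emeasure lborel B"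
    using nn_integral_distr[of R lborel borel h] by (simp add: h_def)
qed simp

section \<open>Cones generated by the rows of a matrix\<close>

text \<open>The sums run over indices instead of generators, so that a matrix with coinciding rows
  needs no special treatment.\<close>

lemma convex_cone_hull_finite_image:
  fixes f :: "'i \<Rightarrow> 'a::real_vector"
  assumes I: "finite I"
  shows "convex_cone hull (f ` I) = {(\<Sum>i\<in>I. c i *\<^sub>R f i) | c. \<forall>i\<in>I. (0::real) \<le> c i}" (is "_ = ?S")
proof
  show "convex_cone hull (f ` I) \<subseteq> ?S"
  proof (rule hull_minimal)
    show "f ` I \<subseteq> ?S"
    proof clarify
      fix i assume i: "i \<in> I"
      have "(\<Sum>j\<in>I. (if j = i then 1 else 0) *\<^sub>R f j) = f i"
        using I i by (simp add: if_distrib[of "\<lambda>c. c *\<^sub>R _"] sum.delta' cong: if_cong)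
      then show "\<exists>c. f i = (\<Sum>i\<in>I. c i *\<^sub>R f i) \<and> (\<forall>i\<in>I. 0 \<le> c i)"
        by (intro exI[of _ "\<lambda>j. if j = i then 1 else 0"]) auto
    qed
    show "convex_cone ?S"
      unfolding convex_cone_iff
    proof (intro conjI ballI allI impI)
      show "0 \<in> ?S" by (auto intro!: exI[of _ "\<lambda>_. 0"])
      fix x assume "x \<in> ?S"
      then obtain c where c: "x = (\<Sum>i\<in>I. c i *\<^sub>R f i)" "\<forall>i\<in>I. 0 \<le> c i" by auto
      show "x + y \<in> ?S" if "y \<in> ?S" for y
      proof -
        obtain d where "y = (\<Sum>i\<in>I. d i *\<^sub>R f i)" "\<forall>i\<in>I. 0 \<le> d i" using \<open>y \<in> ?S\<close> by auto
        then show ?thesis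
          using c by (auto simp: sum.distrib algebra_simps intro!: exI[of _ "\<lambda>i. c i + d i"])
      qed
      show "t *\<^sub>R x \<in> ?S" if "0 \<le> t" for t
        using c that by (auto simp: scaleR_right.sum intro!: exI[of _ "\<lambda>i. t * c i"])
    qed
  qed
  show "?S \<subseteq> convex_cone hull (f ` I)"
  proof clarify
    fix c :: "'i \<Rightarrow> real" assume c: "\<forall>i\<in>I. 0 \<le> c i"
    have "J \<subseteq> I \<Longrightarrow> (\<Sum>i\<in>J. c i *\<^sub>R f i) \<in> convex_cone hull (f ` I)" if "finite J" for J
      using that
    proof induction
      case empty
      then show ?case by (simp add: convex_cone_hull_contains_0)
    next
      case (insert j J)
      have "c j *\<^sub>R f j \<in> convex_cone hull (f ` I)"
        using insert.prems c by (intro convex_cone_hull_mul hull_inc) auto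
      then show ?case using insert by (auto intro!: convex_cone_hull_add)
    qed
    then show "(\<Sum>i\<in>I. c i *\<^sub>R f i) \<in> convex_cone hull (f ` I)" using I by blast
  qed
qed

lemma convex_cone_hull_finite_closed_convex_cones:
  fixes S :: "'a::euclidean_space set"
  shows "finite S \<Longrightarrow> convex_cone hull S \<in> closed_convex_cones"
  by (simp add: closed_convex_cones_iff closed_convex_cone_hull convex_cone_convex_cone_hull)

definition cone_of :: "real^'n^'m \<Rightarrow> (real^'n) set" where
  "cone_of v = convex_cone hull (range (($) v))"

definition upd :: "real^'n^'m \<Rightarrow> 'm \<Rightarrow> real^'n \<Rightarrow> real^'n^'m" where
  "upd v i x = (\<chi> j. if j = i then x else v $ j)"

lemma upd_nth [simp]: "upd v i x $ j = (if j = i then x else v $ j)"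
  by (simp add: upd_def)

lemma upd_upd [simp]: "upd (upd v i x) i y = upd v i y"
  by (simp add: vec_eq_iff)

lemma upd_same [simp]: "upd v i (v $ i) = v"
  by (simp add: vec_eq_iff)

lemma upd_commute: "i \<noteq> j \<Longrightarrow> upd (upd v i x) j y = upd (upd v j y) i x"
  by (simp add: vec_eq_iff)

lemma cone_of_sums: "cone_of v = {(\<Sum>i\<in>UNIV. c i *\<^sub>R v $ i) | c. \<forall>i. (0::real) \<le> c i}"
  unfolding cone_of_def by (subst convex_cone_hull_finite_image) auto

lemma cone_of_closed_convex_cones: "cone_of v \<in> closed_convex_cones"
  by (simp add: cone_of_def convex_cone_hull_finite_closed_convex_cones)

lemma row_mem_cone_of: "v $ i \<in> cone_of v"
  by (simp add: cone_of_def hull_inc)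

lemma det_upd_scaleR: "det (upd v i (c *\<^sub>R x)) = c * det (upd v i x)"
  unfolding upd_def using det_row_mul[of i c "\<lambda>_. x" "($) v", unfolded scalar_mult_eq_scaleR] by simp

text \<open>Cramer's rule for the transpose, after extending the coefficients by zero outside
  \<open>I\<close>.\<close>

lemma det_upd_sum:
  assumes "i \<in> I"
  shows "det (upd v i (\<Sum>j\<in>I. a j *\<^sub>R v $ j)) = a i * det v"
proof -
  define x where "x = (\<chi> j. if j \<in> I then a j else 0)"
  have "(\<Sum>j\<in>UNIV. x $ j *s row j v) = (\<Sum>j\<in>I. a j *\<^sub>R v $ j)"
    by (simp add: x_def row_def scalar_mult_eq_scaleR if_distrib[of "\<lambda>c. c *\<^sub>R _"]
        sum.If_cases cong: if_cong)
  then have "det (upd v i (\<Sum>j\<in>I. a j *\<^sub>R v $ j)) = x $ i * det v"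
    unfolding cramer_lemma_transpose[symmetric] by (simp add: upd_def row_def cong: if_cong)
  then show ?thesis using assms by (simp add: x_def)
qed

section \<open>Dual bases\<close>

text \<open>The rows of \<open>w\<close> are the basis dual to the rows of \<open>v\<close>: they
  read off coordinates and are the inner facet normals of \<open>cone_of v\<close>.\<close>

definition dual_rows :: "real^'n^'n \<Rightarrow> real^'n^'n \<Rightarrow> bool" where
  "dual_rows v w \<longleftrightarrow> (\<forall>i j. v $ i \<bullet> w $ j = (if i = j then 1 else 0))"

lemma dual_rowsD: "dual_rows v w \<Longrightarrow> v $ i \<bullet> w $ j = (if i = j then 1 else 0)"
  by (simp add: dual_rows_def)

lemma dual_rows_matrix: "dual_rows v w \<longleftrightarrow> v ** transpose w = mat 1"
  by (simp add: dual_rows_def vec_eq_iff matrix_matrix_mult_def transpose_def inner_vec_def mat_def)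

lemma dual_rows_exists:
  assumes "det v \<noteq> 0"
  obtains w where "dual_rows v w"
proof -
  obtain B where "v ** B = mat 1"
    using assms by (auto simp: invertible_det_nz[symmetric] invertible_right_inverse)
  then have "dual_rows v (transpose B)" by (simp add: dual_rows_matrix)
  then show ?thesis by (rule that)
qed

lemma dual_rows_det_nz: "dual_rows v w \<Longrightarrow> det v \<noteq> 0"
  by (metis dual_rows_matrix det_I det_mul mult_zero_left zero_neq_one)

text \<open>\<open>transpose w\<close> is a right inverse of the square matrix \<open>v\<close>,
  hence also a left inverse; the expansion is that identity applied to \<open>x\<close>.\<close>

lemma dual_rows_expansion:
  assumes "dual_rows v w"
  shows "x = (\<Sum>j\<in>UNIV. (x \<bullet> w $ j) *\<^sub>R v $ j)"
proof -
  have "transpose w ** v = mat 1"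
    using assms matrix_left_right_inverse by (metis dual_rows_matrix)
  then have "(w *v x) v* v = x"
    by (metis vector_matrix_mul_assoc vector_matrix_mul_rid vector_transpose_matrix)
  moreover have "(w *v x) $ j = x \<bullet> w $ j" for j
    by (simp add: matrix_vector_mult_def inner_vec_def mult.commute)
  ultimately show ?thesis
    by (simp add: vec_eq_iff vector_matrix_mult_def mult.commute)
qed

lemma det_upd_dual:
  assumes "dual_rows v w"
  shows "det (upd v i x) = (x \<bullet> w $ i) * det v"
  using det_upd_sum[of i UNIV v "\<lambda>j. x \<bullet> w $ j"] dual_rows_expansion[OF assms, of x] by simp

text \<open>Passes from generators to inequalities, so that unions and intersections of cones become
  statements about signs of coordinates.\<close>

lemma cone_of_dual:
  assumes "dual_rows v w"
  shows "cone_of v = {y. \<forall>j. 0 \<le> y \<bullet> w $ j}"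
proof
  show "cone_of v \<subseteq> {y. \<forall>j. 0 \<le> y \<bullet> w $ j}"
    unfolding cone_of_def
  proof (rule hull_minimal)
    show "convex_cone {y. \<forall>j. 0 \<le> y \<bullet> w $ j}" by (auto simp: convex_cone_iff inner_simps)
  qed (auto simp: dual_rowsD[OF assms])
  show "{y. \<forall>j. 0 \<le> y \<bullet> w $ j} \<subseteq> cone_of v"
    unfolding cone_of_sums using dual_rows_expansion[OF assms]
    by (auto intro!: exI[of _ "\<lambda>j. _ \<bullet> w $ j"])
qed

lemma dual_rows_upd_scaleR:
  "dual_rows v w \<Longrightarrow> c \<noteq> 0 \<Longrightarrow> dual_rows (upd v i (c *\<^sub>R v $ i)) (upd w i ((1 / c) *\<^sub>R w $ i))"
  by (auto simp: dual_rows_def)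

text \<open>Among the other dual vectors only \<open>w $ k\<close> fails to be orthogonal to the new
  row; a multiple of \<open>w $ i\<close> corrects this, without affecting the products with the
  rows other than the \<open>i\<close>-th.\<close>

lemma dual_rows_upd_combination:
  "dual_rows v w \<Longrightarrow> i \<noteq> k \<Longrightarrow> a \<noteq> 0 \<Longrightarrow>
   dual_rows (upd v i (a *\<^sub>R v $ i + b *\<^sub>R v $ k))
     (upd (upd w i ((1 / a) *\<^sub>R w $ i)) k (w $ k - (b / a) *\<^sub>R w $ i))"
  by (auto simp: dual_rows_def inner_simps)

section \<open>Continuity of the generated cone in its generators\<close>

text \<open>The bound is the length of the chord that subtends the angle \<open>e\<close> on the
  unit sphere.\<close>

lemma spherical_dist_le:
  assumes n: "norm x = 1" "norm y = 1" and e: "0 \<le> e" "e \<le> pi"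
    and le: "norm (x - y) \<le> sqrt (2 * (1 - cos e))"
  shows "spherical_dist x y \<le> e"
proof -
  have "(norm (x - y))\<^sup>2 \<le> (sqrt (2 * (1 - cos e)))\<^sup>2"
    using le by (intro power_mono) auto
  then have "(norm (x - y))\<^sup>2 \<le> 2 * (1 - cos e)" by simp
  moreover have "(norm (x - y))\<^sup>2 = 2 - 2 * (x \<bullet> y)"
    using n by (simp add: power2_norm_eq_inner inner_diff inner_commute norm_eq_1)
  ultimately have "cos e \<le> x \<bullet> y" by simp
  moreover have "\<bar>x \<bullet> y\<bar> \<le> 1" using Cauchy_Schwarz_ineq2[of x y] n by simp
  ultimately have "arccos (x \<bullet> y) \<le> arccos (cos e)"
    by (intro arccos_le_mono[THEN iffD2]) (auto simp: abs_le_iff)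
  then show ?thesis using e by (simp add: spherical_dist_def arccos_cos)
qed

lemma excess_leI:
  assumes A: "A \<subseteq> sphere 0 1" "A \<noteq> {}" and B: "B \<subseteq> sphere 0 1"
    and near: "\<And>x. x \<in> A \<Longrightarrow> \<exists>y\<in>B. spherical_dist x y \<le> e"
  shows "excess spherical_dist A B \<le> e"
  unfolding excess_def
proof (rule cSUP_least[OF A(2)])
  fix x assume x: "x \<in> A"
  then obtain y where y: "y \<in> B" "spherical_dist x y \<le> e" using near by blast
  have "x \<in> sphere 0 1" "B \<noteq> {}" using x A y by blast+
  then show "(INF y\<in>B. spherical_dist x y) \<le> e"
    using cINF_lower[OF INF_spherical_bounds(1)[of x B] y(1)] B y by linarith
qed

text \<open>Pairing \<open>x\<close> with \<open>u\<close> bounds the sum of its nonnegative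
  coefficients by \<open>norm u / \<delta>\<close>. Using the same coefficients on the rows of
  \<open>M\<close> therefore moves \<open>x\<close> by at most
  \<open>norm u / \<delta> * norm (N - M)\<close>. Normalizing the result costs at most the same
  amount again, whence the factor 2.\<close>

lemma cone_of_unit_near:
  fixes N M :: "real^'n^'m"
  assumes u: "\<And>i. \<delta> \<le> u \<bullet> N $ i" and \<delta>: "0 < \<delta>"
    and x: "x \<in> cone_of N" "norm x = 1" and small: "norm u / \<delta> * norm (N - M) < 1"
  shows "\<exists>y \<in> cone_of M \<inter> sphere 0 1. norm (x - y) \<le> 2 * (norm u / \<delta> * norm (N - M))"
proof -
  obtain c where c: "x = (\<Sum>i\<in>UNIV. c i *\<^sub>R N $ i)" "\<And>i. 0 \<le> c i"
    using x by (auto simp: cone_of_sums)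
  have "(\<Sum>i\<in>UNIV. c i) * \<delta> \<le> (\<Sum>i\<in>UNIV. c i * (u \<bullet> N $ i))"
    unfolding sum_distrib_right using u c by (intro sum_mono mult_left_mono) auto
  also have "\<dots> = u \<bullet> x" by (simp add: c inner_sum_right)
  also have "\<dots> \<le> norm u" using norm_cauchy_schwarz[of u x] x by simp
  finally have sc: "(\<Sum>i\<in>UNIV. c i) \<le> norm u / \<delta>" using \<delta> by (simp add: field_simps)
  define z where "z = (\<Sum>i\<in>UNIV. c i *\<^sub>R M $ i)"
  define \<eta> where "\<eta> = norm u / \<delta> * norm (N - M)"
  have "norm (x - z) = norm (\<Sum>i\<in>UNIV. c i *\<^sub>R (N - M) $ i)"
    by (simp add: c z_def sum_subtractf scaleR_diff_right)
  also have "\<dots> \<le> (\<Sum>i\<in>UNIV. c i * norm (N - M))"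
  proof (rule sum_norm_le)
    fix i show "norm (c i *\<^sub>R (N - M) $ i) \<le> c i * norm (N - M)"
      using c(2)[of i] Finite_Cartesian_Product.norm_nth_le[of "N - M" i] by (auto intro: mult_left_mono)
  qed
  also have "\<dots> \<le> \<eta>"
    unfolding \<eta>_def sum_distrib_right[symmetric] by (intro mult_right_mono sc) auto
  finally have xz: "norm (x - z) \<le> \<eta>" .
  have d: "\<bar>1 - norm z\<bar> \<le> \<eta>" using xz norm_triangle_ineq3[of x z] x by linarith
  have "\<eta> < 1" using small by (simp only: \<eta>_def)
  then have z0: "norm z > 0" using d by linarith
  let ?y = "(1 / norm z) *\<^sub>R z"
  have "z \<in> cone_of M" using c by (auto simp: cone_of_sums z_def)
  then have "?y \<in> cone_of M" by (simp add: cone_of_def convex_cone_hull_mul)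
  moreover have "norm ?y = 1" using z0 by simp
  moreover have "norm (z - ?y) = \<bar>1 - norm z\<bar>"
  proof -
    have "z - ?y = (1 - 1 / norm z) *\<^sub>R z" by (simp add: algebra_simps)
    then have "norm (z - ?y) = \<bar>1 - 1 / norm z\<bar> * norm z" by simp
    also have "\<dots> = \<bar>(1 - 1 / norm z) * norm z\<bar>" by (simp add: abs_mult)
    also have "(1 - 1 / norm z) * norm z = norm z - 1" using z0 by (simp add: field_simps)
    finally show ?thesis by simp
  qed
  moreover have "norm (x - ?y) \<le> norm (x - z) + norm (z - ?y)"
    using norm_triangle_ineq[of "x - z" "z - ?y"] by simp
  ultimately show ?thesis
    using xz d by (intro bexI[of _ ?y]) (auto simp: \<eta>_def)
qed

lemma cone_of_eq_0_iff: "cone_of v = {0} \<longleftrightarrow> (\<forall>i. v $ i = 0)"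
proof
  assume "cone_of v = {0}"
  then show "\<forall>i. v $ i = 0" using row_mem_cone_of[of v] by auto
qed (auto simp: cone_of_sums)

text \<open>The rows have to stay in an open half-space: otherwise the generated cones can jump when a
  limit cone contains a line.\<close>

lemma limitin_cone_of:
  fixes M :: "real^'n^'m"
  assumes X: "(X \<longlongrightarrow> M) F" and u: "\<And>i. 0 < u \<bullet> M $ i"
  shows "limitin cone_topology (\<lambda>k. cone_of (X k)) (cone_of M) F"
proof -
  interpret cones: Metric_space "closed_convex_cones :: (real^'n) set set" cone_dist
    by (rule Metric_space_closed_convex_cones)
  \<comment> \<open>Half of the smallest margin, so that the rows of \<open>X k\<close> eventually
    keep the margin \<open>\<delta>\<close> as well.\<close>
  define \<delta> where "\<delta> = Min (range (\<lambda>i. u \<bullet> M $ i)) / 2"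
  have "0 < Min (range (\<lambda>i. u \<bullet> M $ i))" using u by (subst Min_gr_iff) auto
  then have \<delta>: "0 < \<delta>" by (simp add: \<delta>_def)
  have M: "\<delta> < u \<bullet> M $ i" for i
  proof -
    have "2 * \<delta> \<le> u \<bullet> M $ i" by (simp add: \<delta>_def)
    then show ?thesis using \<delta> by linarith
  qed
  \<comment> \<open>Halving \<open>e\<close> turns the weak bounds on the excesses into a strict
    one; the cap \<open>pi\<close> keeps \<open>e'\<close> in the range where \<open>arccos\<close>
    inverts \<open>cos\<close>.\<close>
  have "cone_dist (cone_of (X k)) (cone_of M) < e" if "0 < e" "e' = min (e / 2) pi"
    and Xk: "\<And>i. \<delta> < u \<bullet> X k $ i" and s1: "norm u / \<delta> * norm (X k - M) < 1"
    and s2: "2 * (norm u / \<delta> * norm (X k - M)) < sqrt (2 * (1 - cos e'))" for e e' k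
  proof -
    have e': "0 \<le> e'" "e' \<le> pi" "e' < e" using that by auto
    let ?C = "cone_of (X k)" and ?D = "cone_of M" and ?S = "sphere (0 :: real^'n) 1"
    have s1': "norm u / \<delta> * norm (M - X k) < 1"
      and s2': "2 * (norm u / \<delta> * norm (M - X k)) < sqrt (2 * (1 - cos e'))"
      using s1 s2 by (simp_all add: norm_minus_commute)
    have ne: "?C \<noteq> {0}" "?D \<noteq> {0}"
      using Xk M \<delta> unfolding cone_of_eq_0_iff by (metis inner_zero_right order.asym)+
    have ne': "?C \<inter> ?S \<noteq> {}" "?D \<inter> ?S \<noteq> {}"
      using ne by (simp_all add: closed_convex_cone_link cone_of_closed_convex_cones)
    have "excess spherical_dist (?C \<inter> ?S) (?D \<inter> ?S) \<le> e'"
    proof (rule excess_leI)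
      fix x assume x: "x \<in> ?C \<inter> ?S"
      then obtain y where y: "y \<in> ?D \<inter> ?S" "norm (x - y) \<le> 2 * (norm u / \<delta> * norm (X k - M))"
        using cone_of_unit_near[of \<delta> u "X k" x M] Xk \<delta> s1 by (force simp: less_imp_le)
      then show "\<exists>y\<in>?D \<inter> ?S. spherical_dist x y \<le> e'"
        using x s2 e' by (intro bexI[of _ y] spherical_dist_le) auto
    qed (use ne' in auto)
    moreover have "excess spherical_dist (?D \<inter> ?S) (?C \<inter> ?S) \<le> e'"
    proof (rule excess_leI)
      fix x assume x: "x \<in> ?D \<inter> ?S"
      then obtain y where y: "y \<in> ?C \<inter> ?S" "norm (x - y) \<le> 2 * (norm u / \<delta> * norm (M - X k))"
        using cone_of_unit_near[of \<delta> u M x "X k"] M \<delta> s1' by (force simp: less_imp_le)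
      then show "\<exists>y\<in>?C \<inter> ?S. spherical_dist x y \<le> e'"
        using x s2' e' by (intro bexI[of _ y] spherical_dist_le) auto
    qed (use ne' in auto)
    ultimately show ?thesis
      using ne e' by (simp add: cone_dist_def cone_of_closed_convex_cones
          hausdorff_distance_excess[of spherical_dist, OF spherical_dist_commute])
  qed
  note close = this
  have lim0: "((\<lambda>k. norm u / \<delta> * norm (X k - M)) \<longlongrightarrow> 0) F"
    using tendsto_mult[OF tendsto_const[of "norm u / \<delta>"] tendsto_norm[OF LIM_zero[OF X]]] by simp
  have ev1: "\<forall>\<^sub>F k in F. \<forall>i. \<delta> < u \<bullet> X k $ i"
  proof (rule eventually_all_finite)
    fix i have "((\<lambda>k. u \<bullet> X k $ i) \<longlongrightarrow> u \<bullet> M $ i) F" by (intro tendsto_intros X)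
    then show "\<forall>\<^sub>F k in F. \<delta> < u \<bullet> X k $ i" using M[of i] by (rule order_tendstoD)
  qed
  show ?thesis
    unfolding cone_topology_def cones.limitin_metric
  proof (intro conjI allI impI)
    fix e :: real assume e: "0 < e"
    define e' where "e' = min (e / 2) pi"
    have "cos e' < 1" using cos_monotone_0_pi[of 0 e'] e by (simp add: e'_def)
    then have "0 < sqrt (2 * (1 - cos e')) / 2" by simp
    then have "\<forall>\<^sub>F k in F. norm u / \<delta> * norm (X k - M) < sqrt (2 * (1 - cos e')) / 2"
      by (rule order_tendstoD(2)[OF lim0])
    moreover have "\<forall>\<^sub>F k in F. norm u / \<delta> * norm (X k - M) < 1"
      by (rule order_tendstoD(2)[OF lim0]) simp
    ultimately show "\<forall>\<^sub>F k in F. cone_of (X k) \<in> closed_convex_cones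
        \<and> cone_dist (cone_of (X k)) (cone_of M) < e"
      using ev1
    proof eventually_elim
      case (elim k)
      then show ?case
        by (intro conjI cone_of_closed_convex_cones close[OF e e'_def]) (blast | linarith)+
    qed
  qed (rule cone_of_closed_convex_cones)
qed

section \<open>Determinants and generic vectors\<close>

lemma tendsto_det:
  fixes X :: "'b \<Rightarrow> real^'n^'n"
  shows "(X \<longlongrightarrow> M) F \<Longrightarrow> ((\<lambda>k. det (X k)) \<longlongrightarrow> det M) F"
  unfolding det_def by (intro tendsto_intros)

lemma AE_lborel_inner_nonzero:
  fixes a :: "'a::euclidean_space"
  assumes "a \<noteq> 0"
  shows "AE x in lborel. x \<bullet> a \<noteq> 0"
proof -
  have "negligible {x. a \<bullet> x = 0}" using assms by (intro negligible_hyperplane) auto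
  then have "{x. a \<bullet> x = 0} \<in> null_sets lborel"
    by (simp add: negligible_iff_null_sets closed_hyperplane borel_closed null_sets_completion_iff)
  then have "AE x in lborel. x \<notin> {x. a \<bullet> x = 0}" by (rule AE_not_in)
  then show ?thesis by (simp add: inner_commute)
qed

text \<open>Each forbidden hyperplane is a null set, and finitely many null sets do not cover the
  space.\<close>

lemma exists_inner_nonzero:
  fixes f :: "'i::finite \<Rightarrow> 'a::euclidean_space"
  assumes "\<And>i. f i \<noteq> 0"
  obtains u where "\<And>i. u \<bullet> f i \<noteq> 0"
proof -
  have "AE u in lborel. \<forall>i. u \<bullet> f i \<noteq> 0"
    using AE_lborel_inner_nonzero[OF assms] by (simp add: AE_all_countable)
  moreover have "ae_filter (lborel :: 'a measure) \<noteq> bot"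
    by (simp add: ae_filter_eq_bot_iff emeasure_lborel_UNIV)
  ultimately show ?thesis
    using that eventually_happens' by blast
qed

lemma det_0_normal:
  fixes v :: "real^'n^'n"
  assumes "det v = 0"
  obtains a where "a \<noteq> 0" "\<And>i. v $ i \<bullet> a = 0"
proof -
  have "\<not> (\<exists>B. B ** v = mat 1)"
    using assms by (metis invertible_det_nz invertible_left_inverse)
  then obtain a where a: "v *v a = 0" "a \<noteq> 0" by (auto simp: matrix_left_invertible_ker)
  have "v $ i \<bullet> a = (v *v a) $ i" for i
    by (simp add: matrix_vector_mult_def inner_vec_def)
  with a that show ?thesis by simp
qed

section \<open>The signed valuation and its continuity\<close>

locale line_free_valuation =
  fixes \<mu> :: "(real^'n) set \<Rightarrow> real"
  assumes valuation: "cone_valuation \<mu>"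
    and continuous: "continuous_map cone_topology euclideanreal \<mu>"
    and invariant: "orthogonally_invariant \<mu>"
    and lowdim_or_line: "\<And>C. C \<in> closed_convex_cones \<Longrightarrow> dim C < CARD('n) \<or> contains_line C \<Longrightarrow> \<mu> C = 0"
begin

text \<open>The function \<open>F\<close> from the introduction; since \<open>sgn 0 = 0\<close>, it
  vanishes at singular matrices.\<close>

definition signed :: "real^'n^'n \<Rightarrow> real" where
  "signed v = sgn (det v) * \<mu> (cone_of v)"

lemma hyperplane_zero:
  assumes "C \<in> closed_convex_cones" "a \<noteq> 0" "C \<subseteq> {x. x \<bullet> a = 0}"
  shows "\<mu> C = 0"
proof -
  have "dim C \<le> dim {x. a \<bullet> x = 0}" using assms by (intro dim_subset) (auto simp: inner_commute)
  also have "\<dots> < CARD('n)" using assms by (simp add: dim_hyperplane)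
  finally show ?thesis using assms lowdim_or_line by blast
qed

lemma degenerate_zero: "det v = 0 \<Longrightarrow> \<mu> (cone_of v) = 0"
proof -
  assume "det v = 0"
  then obtain a where a: "a \<noteq> 0" "\<And>i. v $ i \<bullet> a = 0" using det_0_normal by blast
  have "cone_of v \<subseteq> {x. x \<bullet> a = 0}"
    unfolding cone_of_def using a by (intro hull_minimal) (auto simp: convex_cone_iff inner_simps)
  then show ?thesis using a by (intro hyperplane_zero cone_of_closed_convex_cones)
qed

text \<open>The overlap lies in a hyperplane, so its term in the valuation identity
  vanishes.\<close>

lemma valuationD:
  assumes "C \<in> closed_convex_cones" "D \<in> closed_convex_cones" "C \<union> D \<in> closed_convex_cones"
    and "a \<noteq> 0" "C \<inter> D \<subseteq> {x. x \<bullet> a = 0}"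
  shows "\<mu> (C \<union> D) = \<mu> C + \<mu> D"
proof -
  have "C \<inter> D \<in> closed_convex_cones"
    using assms(1,2) by (auto simp: closed_convex_cones_iff closed_Int convex_cone_iff)
  then have "\<mu> (C \<inter> D) = 0" using assms by (intro hyperplane_zero)
  then show ?thesis using valuation assms(1-3) unfolding cone_valuation_def by force
qed

text \<open>Reversing row \<open>i\<close> reverses only the inequality for \<open>w $ i\<close>.
  The two cones meet in the hyperplane orthogonal to \<open>w $ i\<close>, and their union
  \<open>U\<close> lacks that inequality, so it contains the line through \<open>v $ i\<close> and
  has value 0.\<close>

lemma cone_of_negate_row:
  assumes vw: "dual_rows v w" and c: "c < 0"
  shows "\<mu> (cone_of (upd v i (c *\<^sub>R v $ i))) = - \<mu> (cone_of v)"
proof -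
  let ?D = "cone_of (upd v i (c *\<^sub>R v $ i))"
  define U where "U = {y. \<forall>j. j \<noteq> i \<longrightarrow> 0 \<le> y \<bullet> w $ j}"
  have C: "cone_of v = {y. \<forall>j. 0 \<le> y \<bullet> w $ j}" using vw by (rule cone_of_dual)
  have "?D = {y. \<forall>j. 0 \<le> y \<bullet> upd w i ((1 / c) *\<^sub>R w $ i) $ j}"
    using vw c by (intro cone_of_dual dual_rows_upd_scaleR) auto
  then have D: "?D = U \<inter> {y. y \<bullet> w $ i \<le> 0}"
    using c by (auto simp: U_def zero_le_divide_iff split: if_splits)
  have un: "cone_of v \<union> ?D = U" unfolding C D by (auto simp: U_def) (metis linear)
  have "U = (\<Inter>j\<in>-{i}. {y. 0 \<le> y \<bullet> w $ j})" by (auto simp: U_def)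
  moreover have "closed {y. 0 \<le> y \<bullet> w $ j}" for j
    using closed_halfspace_ge[of 0 "w $ j"] by (simp add: inner_commute)
  ultimately have "closed U" by (simp add: closed_INT)
  moreover have "convex_cone U" by (auto simp: U_def convex_cone_iff inner_simps)
  ultimately have Uc: "U \<in> closed_convex_cones" by (simp add: closed_convex_cones_iff)
  have "v $ i \<bullet> w $ i = 1" "w $ i \<noteq> 0" using dual_rowsD[OF vw, of i i] by auto
  then have "v $ i \<noteq> 0" by auto
  then have "dim (span {v $ i}) = 1" by (simp add: dim_span)
  moreover have "span {v $ i} \<subseteq> U" using dual_rowsD[OF vw] by (auto simp: U_def span_singleton)
  ultimately have "contains_line U" unfolding contains_line_def by blast
  then have "\<mu> U = 0" using lowdim_or_line Uc by blast
  moreover have "cone_of v \<inter> ?D \<subseteq> {y. y \<bullet> w $ i = 0}" unfolding C D by (auto intro: antisym)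
  ultimately show ?thesis
    using valuationD[of "cone_of v" ?D "w $ i"] un Uc \<open>w $ i \<noteq> 0\<close> by (simp add: cone_of_closed_convex_cones)
qed

text \<open>For negative \<open>c\<close> both the determinant's sign and the value of
  \<open>\<mu>\<close> flip; for positive \<open>c\<close> neither changes.\<close>

lemma signed_scaleR:
  assumes c: "c \<noteq> 0"
  shows "signed (upd v i (c *\<^sub>R v $ i)) = signed v"
proof (cases "det v = 0")
  case True
  then show ?thesis by (simp add: signed_def det_upd_scaleR)
next
  case False
  then obtain w where vw: "dual_rows v w" by (rule dual_rows_exists)
  show ?thesis
  proof (cases "c < 0")
    case True
    then show ?thesis
      using cone_of_negate_row[OF vw] by (simp add: signed_def det_upd_scaleR sgn_mult)
  next
    case False
    then have "c > 0" using c by simp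
    then have "cone_of (upd v i (c *\<^sub>R v $ i)) = cone_of v"
      using cone_of_dual[OF vw] cone_of_dual[OF dual_rows_upd_scaleR[OF vw c, of i]]
      by (auto simp: zero_le_divide_iff split: if_splits)
    then show ?thesis using \<open>c > 0\<close> by (simp add: signed_def det_upd_scaleR sgn_mult)
  qed
qed

lemma signed_negate_rows:
  "finite J \<Longrightarrow> signed (\<chi> i. if i \<in> J then - v $ i else v $ i) = signed v"
proof (induction rule: finite_induct)
  case empty
  then show ?case by (simp add: vec_nth_inverse)
next
  case (insert j J)
  let ?v = "\<lambda>J. \<chi> i. if i \<in> J then - v $ i else v $ i"
  have "?v (insert j J) = upd (?v J) j (-1 *\<^sub>R ?v J $ j)"
    using insert by (auto simp: vec_eq_iff)
  then show ?case using signed_scaleR[of "-1" "?v J" j] insert by simp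
qed

text \<open>At a nonsingular limit the sign of the determinant is continuous. At a singular one it
  may oscillate, but it is multiplied by values of \<open>\<mu>\<close> that tend to 0.\<close>

lemma signed_tendsto_halfspace:
  assumes X: "(X \<longlongrightarrow> M) F" and u: "\<And>i. 0 < u \<bullet> M $ i"
  shows "((\<lambda>k. signed (X k)) \<longlongrightarrow> signed M) F"
proof -
  have mu: "((\<lambda>k. \<mu> (cone_of (X k))) \<longlongrightarrow> \<mu> (cone_of M)) F"
    using continuous_map_limit[OF continuous limitin_cone_of[OF X u]] by (simp add: o_def)
  show ?thesis
  proof (cases "det M = 0")
    case True
    have "((\<lambda>k. \<bar>\<mu> (cone_of (X k))\<bar>) \<longlongrightarrow> 0) F"
      using tendsto_rabs[OF mu] degenerate_zero[OF True] by simp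
    then have "((\<lambda>k. signed (X k)) \<longlongrightarrow> 0) F"
      by (rule Lim_null_comparison[rotated])
        (auto simp: signed_def abs_mult abs_sgn_eq intro!: always_eventually)
    then show ?thesis using True by (simp add: signed_def)
  next
    case False
    then show ?thesis
      unfolding signed_def by (intro tendsto_intros tendsto_det X mu)
  qed
qed

text \<open>Flipping the signs of rows, which does not change \<^term>\<open>signed\<close>, moves all rows of the
  limit into an open half-space; this is what makes \<^term>\<open>signed\<close> continuous at degenerate
  matrices too.\<close>

lemma signed_tendsto:
  assumes X: "(X \<longlongrightarrow> M) F" and M: "\<And>i. M $ i \<noteq> 0"
  shows "((\<lambda>k. signed (X k)) \<longlongrightarrow> signed M) F"
proof -
  obtain u where u: "\<And>i. u \<bullet> M $ i \<noteq> 0" using exists_inner_nonzero[of "($) M"] M by blast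
  define J where "J = {i. u \<bullet> M $ i < 0}"
  let ?f = "\<lambda>v :: real^'n^'n. \<chi> i. if i \<in> J then - v $ i else v $ i"
  have "((\<lambda>k. ?f (X k)) \<longlongrightarrow> ?f M) F"
  proof (rule vec_tendstoI)
    fix i have "((\<lambda>k. X k $ i) \<longlongrightarrow> M $ i) F" by (intro tendsto_intros X)
    then show "((\<lambda>k. ?f (X k) $ i) \<longlongrightarrow> ?f M $ i) F" by (auto intro: tendsto_minus)
  qed
  moreover have "0 < u \<bullet> ?f M $ i" for i using u[of i] by (auto simp: J_def)
  ultimately have "((\<lambda>k. signed (?f (X k))) \<longlongrightarrow> signed (?f M)) F"
    by (rule signed_tendsto_halfspace)
  then show ?thesis using signed_negate_rows[of J] by simp
qed

section \<open>Stellar subdivision\<close>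

text \<open>The hyperplane through \<open>x\<close> and the rows other than \<open>i\<close> and
  \<open>k\<close> cuts the cone into the two cones on the right. As \<open>a\<close> and
  \<open>b\<close> are positive, all three determinants have the same sign.\<close>

lemma signed_split_pos:
  assumes vw: "dual_rows v w" and ik: "i \<noteq> k" and ab: "0 < a" "0 < b"
    and x: "x = a *\<^sub>R v $ i + b *\<^sub>R v $ k"
  shows "signed v = signed (upd v i x) + signed (upd v k x)"
proof -
  let ?C = "cone_of (upd v i x)" and ?D = "cone_of (upd v k x)"
  define E where "E = {y. \<forall>j. j \<noteq> i \<longrightarrow> j \<noteq> k \<longrightarrow> 0 \<le> y \<bullet> w $ j}"
  have C: "cone_of v = E \<inter> {y. 0 \<le> y \<bullet> w $ i \<and> 0 \<le> y \<bullet> w $ k}"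
    unfolding cone_of_dual[OF vw] E_def by auto
  have "?C = {y. \<forall>j. 0 \<le> y \<bullet> upd (upd w i ((1 / a) *\<^sub>R w $ i)) k (w $ k - (b / a) *\<^sub>R w $ i) $ j}"
    unfolding x using vw ik ab by (intro cone_of_dual dual_rows_upd_combination) auto
  also have "\<dots> = E \<inter> {y. 0 \<le> y \<bullet> w $ i \<and> b * (y \<bullet> w $ i) \<le> a * (y \<bullet> w $ k)}"
    using ik ab unfolding E_def by (auto simp: inner_simps field_simps split: if_splits)
  finally have C1: "?C = \<dots>" .
  have "?D = {y. \<forall>j. 0 \<le> y \<bullet> upd (upd w k ((1 / b) *\<^sub>R w $ k)) i (w $ i - (a / b) *\<^sub>R w $ k) $ j}"
    unfolding x add.commute[of "a *\<^sub>R _"] using vw ik ab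
    by (intro cone_of_dual dual_rows_upd_combination) auto
  also have "\<dots> = E \<inter> {y. 0 \<le> y \<bullet> w $ k \<and> a * (y \<bullet> w $ k) \<le> b * (y \<bullet> w $ i)}"
    using ik ab unfolding E_def by (auto simp: inner_simps field_simps split: if_splits)
  finally have C2: "?D = \<dots>" .
  \<comment> \<open>On each side of the cut, the inequality of \<open>cone_of v\<close> that is not
    listed follows from the two that are.\<close>
  have pos: "0 \<le> y \<bullet> w $ k" if "0 \<le> y \<bullet> w $ i" "b * (y \<bullet> w $ i) \<le> a * (y \<bullet> w $ k)" for y
    using that ab by (metis mult_nonneg_nonneg less_imp_le order_trans zero_le_mult_iff not_less)
  have pos': "0 \<le> y \<bullet> w $ i" if "0 \<le> y \<bullet> w $ k" "a * (y \<bullet> w $ k) \<le> b * (y \<bullet> w $ i)" for y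
    using that ab by (metis mult_nonneg_nonneg less_imp_le order_trans zero_le_mult_iff not_less)
  have un: "?C \<union> ?D = cone_of v" unfolding C C1 C2 using pos pos' by fastforce
  \<comment> \<open>The normal of the cutting hyperplane: it is orthogonal to \<open>x\<close> and
    to all rows except \<open>i\<close> and \<open>k\<close>.\<close>
  define n where "n = b *\<^sub>R w $ i - a *\<^sub>R w $ k"
  have "v $ i \<bullet> n = b" using dual_rowsD[OF vw] ik by (simp add: n_def inner_simps)
  then have "n \<noteq> 0" using ab by auto
  moreover have "?C \<inter> ?D \<subseteq> {y. y \<bullet> n = 0}" unfolding C1 C2 n_def by (auto simp: inner_simps)
  ultimately have "\<mu> (cone_of v) = \<mu> ?C + \<mu> ?D"
    using valuationD[of ?C ?D n] un by (simp add: cone_of_closed_convex_cones)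
  moreover have "det (upd v i x) = a * det v" "det (upd v k x) = b * det v"
    using dual_rowsD[OF vw] ik by (simp_all add: det_upd_dual[OF vw] x inner_simps)
  ultimately show ?thesis using ab by (simp add: signed_def sgn_mult distrib_left)
qed

text \<open>The signs of \<open>a\<close> and \<open>b\<close> are absorbed into rows
  \<open>i\<close> and \<open>k\<close>, which leaves \<open>signed\<close> unchanged and reduces to
  positive coefficients.\<close>

lemma signed_split:
  assumes v: "det v \<noteq> 0" and ik: "i \<noteq> k" and ab: "a \<noteq> 0" "b \<noteq> 0"
    and x: "x = a *\<^sub>R v $ i + b *\<^sub>R v $ k"
  shows "signed v = signed (upd v i x) + signed (upd v k x)"
proof -
  define v' where "v' = upd (upd v i (sgn a *\<^sub>R v $ i)) k (sgn b *\<^sub>R v $ k)"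
  have sg: "sgn a \<noteq> 0" "sgn b \<noteq> 0" using ab by (auto simp: sgn_zero_iff)
  have "v' = upd (upd v i (sgn a *\<^sub>R v $ i)) k (sgn b *\<^sub>R upd v i (sgn a *\<^sub>R v $ i) $ k)"
    using ik by (simp add: v'_def)
  then have 1: "signed v' = signed v" by (simp only: signed_scaleR[OF sg(1)] signed_scaleR[OF sg(2)])
  have "upd v' i x = upd (upd v i x) k (sgn b *\<^sub>R upd v i x $ k)"
    using ik by (auto simp: v'_def vec_eq_iff)
  then have 2: "signed (upd v' i x) = signed (upd v i x)" by (simp only: signed_scaleR[OF sg(1)] signed_scaleR[OF sg(2)])
  have "upd v' k x = upd (upd v k x) i (sgn a *\<^sub>R upd v k x $ i)"
    using ik by (auto simp: v'_def vec_eq_iff)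
  then have 3: "signed (upd v' k x) = signed (upd v k x)" by (simp only: signed_scaleR[OF sg(1)] signed_scaleR[OF sg(2)])
  have "det v' = sgn b * (sgn a * det v)"
    using det_upd_scaleR[of "upd v i (sgn a *\<^sub>R v $ i)" k "sgn b" "v $ k"] ik
      upd_same[of "upd v i (sgn a *\<^sub>R v $ i)" k]
    by (simp add: v'_def det_upd_scaleR)
  then have "det v' \<noteq> 0" using v sg by simp
  then obtain w where w: "dual_rows v' w" by (rule dual_rows_exists)
  have "x = \<bar>a\<bar> *\<^sub>R v' $ i + \<bar>b\<bar> *\<^sub>R v' $ k"
    using ik by (simp add: v'_def x abs_mult_sgn)
  from signed_split_pos[OF w ik _ _ this] show ?thesis using ab 1 2 3 by simp
qed

text \<open>Induction on \<open>I\<close>: subdivide first at the partial sum \<open>y\<close>, then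
  split each piece at \<open>x\<close>, which lies in the plane of \<open>y\<close> and
  \<open>v $ k\<close>. The surplus pieces are the subdivision of \<open>upd v k x\<close> at
  \<open>y\<close>, so the induction hypothesis is needed for that matrix too.\<close>

lemma signed_stellar:
  assumes "finite I" "I \<noteq> {}" "\<And>i. i \<in> I \<Longrightarrow> a i \<noteq> 0" "det v \<noteq> 0"
  shows "signed v = (\<Sum>i\<in>I. signed (upd v i (\<Sum>j\<in>I. a j *\<^sub>R v $ j)))"
  using assms
proof (induction arbitrary: v rule: finite_ne_induct)
  case (singleton i)
  then show ?case by (simp add: signed_scaleR)
next
  case (insert k I)
  define y where "y = (\<Sum>j\<in>I. a j *\<^sub>R v $ j)"
  define x where "x = a k *\<^sub>R v $ k + y"
  have x: "x = (\<Sum>j\<in>insert k I. a j *\<^sub>R v $ j)" using insert by (simp add: x_def y_def)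
  have k: "k \<notin> I" by fact
  have "signed v = (\<Sum>i\<in>I. signed (upd v i y))" using insert by (simp add: y_def)
  also have "\<dots> = (\<Sum>i\<in>I. signed (upd v i x) + signed (upd (upd v k x) i y))"
  proof (rule sum.cong)
    fix i assume i: "i \<in> I"
    then have ik: "i \<noteq> k" using k by auto
    have "det (upd v i y) \<noteq> 0" using i insert by (simp add: y_def det_upd_sum)
    \<comment> \<open>Row \<open>i\<close> of \<open>upd v i y\<close> is \<open>y\<close>, so
      \<open>x\<close> has coefficients 1 and \<open>a k\<close> with respect to rows
      \<open>i\<close> and \<open>k\<close>.\<close>
    from signed_split[OF this ik, of 1 "a k" x]
    show "signed (upd v i y) = signed (upd v i x) + signed (upd (upd v k x) i y)"
      using ik insert.prems by (simp add: x_def upd_commute)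
  qed simp
  also have "\<dots> = (\<Sum>i\<in>I. signed (upd v i x)) + signed (upd v k x)"
  proof -
    have "(\<Sum>j\<in>I. a j *\<^sub>R upd v k x $ j) = y"
      unfolding y_def using k by (intro sum.cong) auto
    moreover have "det (upd v k x) \<noteq> 0" using insert.prems by (simp only: x) (subst det_upd_sum, auto)
    ultimately show ?thesis using insert.IH[of "upd v k x"] insert.prems by (simp add: sum.distrib)
  qed
  finally show ?case using insert.hyps by (simp add: x[symmetric])
qed

section \<open>Averaging over a spherical shell\<close>

text \<open>\<open>R\<close> is the reflection in the hyperplane orthogonal to \<open>w $ i\<close>,
  which contains every row of \<open>v\<close> but the \<open>i\<close>-th. It carries one cone to
  the other, so \<open>\<mu>\<close> agrees on them, while the determinant changes sign.\<close>

lemma signed_reflect: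
  fixes i :: 'n
  assumes vw: "dual_rows v w"
  defines "R \<equiv> \<lambda>x. x - (2 * (x \<bullet> w $ i) / (w $ i \<bullet> w $ i)) *\<^sub>R w $ i"
  shows "orthogonal_transformation R" "signed (upd v i (R x)) = - signed (upd v i x)"
proof -
  have w0: "w $ i \<bullet> w $ i \<noteq> 0" using dual_rowsD[OF vw, of i i] by auto
  define c where "c = 2 / (w $ i \<bullet> w $ i)"
  have R: "R x = x - (c * (x \<bullet> w $ i)) *\<^sub>R w $ i" for x
    by (simp add: R_def c_def)
  have c: "c * (w $ i \<bullet> w $ i) = 2" using w0 by (simp add: c_def)
  have lin: "linear R"
    by (rule linearI) (simp_all add: R inner_add_left algebra_simps)
  have "R x \<bullet> R y = x \<bullet> y" for x y
  proof -
    have "R x \<bullet> R y = x \<bullet> y - 2 * c * ((x \<bullet> w $ i) * (y \<bullet> w $ i))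
        + c * (c * (w $ i \<bullet> w $ i)) * ((x \<bullet> w $ i) * (y \<bullet> w $ i))"
      by (simp add: R inner_diff_left inner_diff_right inner_commute[of "w $ i" y] algebra_simps)
    then show ?thesis unfolding c by simp
  qed
  then show orth: "orthogonal_transformation R"
    unfolding orthogonal_transformation_def using lin by blast
  have "(R x) \<bullet> w $ i = - (x \<bullet> w $ i)" using c by (simp add: R inner_diff_left mult.assoc mult.left_commute)
  then have 1: "det (upd v i (R x)) = - det (upd v i x)" by (simp add: det_upd_dual[OF vw])
  have "R (v $ j) = v $ j" if "j \<noteq> i" for j using that dual_rowsD[OF vw] by (simp add: R_def)
  then have "($) (upd v i (R x)) = R \<circ> ($) (upd v i x)" by (auto simp: fun_eq_iff)
  then have "cone_of (upd v i (R x)) = R ` cone_of (upd v i x)"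
    unfolding cone_of_def convex_cone_hull_linear_image[OF lin, symmetric] by (metis image_comp)
  then have "\<mu> (cone_of (upd v i (R x))) = \<mu> (cone_of (upd v i x))"
    using invariant orth by (simp add: orthogonally_invariant_def cone_of_closed_convex_cones)
  with 1 show "signed (upd v i (R x)) = - signed (upd v i x)" by (simp add: signed_def sgn_minus)
qed

lemma signed_zero:
  assumes vw: "dual_rows v w"
  shows "signed v = 0"
proof -
  \<comment> \<open>Excluding a ball around 0 keeps the inserted row nonzero, so
    \<open>signed\<close> is continuous on the compact set \<open>A\<close> and hence integrable
    there.\<close>
  define A where "A = cball (0::real^'n) 2 - ball 0 1"
  have A: "compact A" by (simp add: A_def compact_diff)
  have Aset: "x \<in> A \<longleftrightarrow> 1 \<le> norm x \<and> norm x \<le> 2" for x by (auto simp: A_def)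
  define f where "f i x = indicator A x *\<^sub>R signed (upd v i x)" for i x
  have cont: "continuous_on A (\<lambda>x. signed (upd v i x))" for i
    unfolding continuous_on_def
  proof
    fix x assume x: "x \<in> A"
    have "((\<lambda>x. upd v i x) \<longlongrightarrow> upd v i x) (at x within A)"
      by (rule vec_tendstoI) (auto intro: tendsto_intros)
    moreover have "upd v i x $ j \<noteq> 0" for j
      using x dual_rowsD[OF vw, of j j] by (auto simp: Aset)
    ultimately show "((\<lambda>x. signed (upd v i x)) \<longlongrightarrow> signed (upd v i x)) (at x within A)"
      by (rule signed_tendsto)
  qed
  have int: "integrable lborel (f i)" for i
    unfolding f_def by (rule borel_integrable_compact[OF A cont])
  \<comment> \<open>\<open>R\<close> preserves Lebesgue measure and, being an isometry fixing 0, the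
    shell; so the integral equals its own negative.\<close>
  have zero: "(\<integral>x. f i x \<partial>lborel) = 0" for i
  proof -
    define R where "R = (\<lambda>x. x - (2 * (x \<bullet> w $ i) / (w $ i \<bullet> w $ i)) *\<^sub>R w $ i)"
    have R: "orthogonal_transformation R" "\<And>x. signed (upd v i (R x)) = - signed (upd v i x)"
      unfolding R_def using signed_reflect[OF vw] by blast+
    have meas: "R \<in> borel_measurable lborel"
      using orthogonal_transformation_linear[OF R(1)]
      by (simp add: borel_measurable_continuous_onI linear_continuous_on linear_conv_bounded_linear)
    have "f i (R x) = - f i x" for x
      using R orthogonal_transformation_norm[OF R(1), of x] by (simp add: f_def Aset indicator_def)
    moreover have "(\<integral>x. f i x \<partial>lborel) = (\<integral>x. f i x \<partial>distr lborel borel R)"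
      using distr_lborel_orthogonal[OF R(1)] by simp
    moreover have "\<dots> = (\<integral>x. f i (R x) \<partial>lborel)"
      using int[of i] meas by (intro integral_distr) auto
    ultimately show ?thesis by simp
  qed
  \<comment> \<open>\<open>signed_stellar\<close> requires all coordinates of \<open>x\<close> in
    the basis \<open>v\<close> to be nonzero.\<close>
  have "AE x in lborel. \<forall>i. x \<bullet> w $ i \<noteq> 0"
    unfolding AE_all_countable
  proof
    fix i :: 'n show "AE x in lborel. x \<bullet> w $ i \<noteq> 0"
      using dual_rowsD[OF vw, of i i] by (intro AE_lborel_inner_nonzero) auto
  qed
  then have "AE x in lborel. indicator A x *\<^sub>R signed v = (\<Sum>i\<in>UNIV. f i x)"
  proof eventually_elim
    case (elim x)
    then have "signed v = (\<Sum>i\<in>UNIV. signed (upd v i (\<Sum>j\<in>UNIV. (x \<bullet> w $ j) *\<^sub>R v $ j)))"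
      using dual_rows_det_nz[OF vw] by (intro signed_stellar) auto
    then have "signed v = (\<Sum>i\<in>UNIV. signed (upd v i x))"
      using dual_rows_expansion[OF vw, of x] by simp
    then show ?case by (simp add: f_def sum_distrib_left)
  qed
  then have "(\<integral>x. indicator A x *\<^sub>R signed v \<partial>lborel) = (\<integral>x. (\<Sum>i\<in>UNIV. f i x) \<partial>lborel)"
    using int borel_integrable_compact[OF A continuous_on_const[of A "signed v"]]
    by (intro integral_cong_AE borel_measurable_sum) (blast intro: borel_measurable_integrable)+
  also have "\<dots> = 0" using int zero by (simp add: Bochner_Integration.integral_sum)
  finally have "measure lborel A * signed v = 0"
    using A emeasure_compact_finite[OF A] by (simp add: borel_compact)
  moreover have "0 < measure lborel A"
  proof -
    \<comment> \<open>A point midway between the two bounding spheres; the ball of radius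
      \<open>1 / 2\<close> around it lies in the shell.\<close>
    obtain b :: "real^'n" where b: "norm b = 3 / 2" using vector_choose_size[of "3 / 2"] by auto
    have "ball b (1 / 2) \<subseteq> A"
    proof
      fix x assume "x \<in> ball b (1 / 2)"
      then have "norm (b - x) < 1 / 2" by (simp add: dist_norm)
      then show "x \<in> A" using b norm_triangle_ineq3[of b x] by (auto simp: Aset)
    qed
    then have "measure lborel (ball b (1 / 2)) \<le> measure lborel A"
      using A emeasure_compact_finite[OF A]
      by (intro measure_mono_fmeasurable) (auto simp: fmeasurable_def borel_compact)
    moreover have "0 < measure lborel (ball b (1 / 2))" by (intro content_ball_pos) simp
    ultimately show ?thesis by linarith
  qed
  ultimately show ?thesis by simp
qed

lemma cone_of_zero:
  fixes v :: "real^'n^'n"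
  shows "\<mu> (cone_of v) = 0"
proof (cases "det v = 0")
  case False
  then obtain w where "dual_rows v w" by (rule dual_rows_exists)
  then have "signed v = 0" by (rule signed_zero)
  then show ?thesis using False by (simp add: signed_def sgn_zero_iff)
qed (rule degenerate_zero)

section \<open>Simplicial cones\<close>

lemma simplicial_zero:
  assumes "simplicial_cone C"
  shows "\<mu> C = 0"
proof -
  obtain B where B: "finite B" "independent B"
    and "C = {(\<Sum>b\<in>B. c b *\<^sub>R b) | c. \<forall>b\<in>B. (0::real) \<le> c b}"
    using assms by (auto simp: simplicial_cone_def)
  then have C: "C = convex_cone hull B"
    using convex_cone_hull_finite_image[of B "\<lambda>b. b"] by simp
  have "card B \<le> CARD('n)" using independent_bound[OF B(2)] by simp
  then consider "card B < CARD('n)" | "card B = CARD('n)" by linarith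
  then show ?thesis
  proof cases
    case 1
    have "C \<subseteq> span B"
      unfolding C by (intro hull_minimal)
        (auto simp: convex_cone_iff span_base span_zero span_add span_scale)
    then have "dim C \<le> card B" using B by (metis dim_le_card)
    then show ?thesis
      using 1 C B lowdim_or_line[of C] by (simp add: convex_cone_hull_finite_closed_convex_cones)
  next
    \<comment> \<open>A full set of generators can be enumerated as the rows of a square
      matrix.\<close>
    case 2
    then obtain f :: "'n \<Rightarrow> real^'n" where "bij_betw f UNIV B"
      using finite_same_card_bij[of "UNIV :: 'n set" B] B by auto
    then have "range f = B" by (simp add: bij_betw_def)
    then have "C = cone_of (\<chi> i. f i)" by (simp add: C cone_of_def)
    then show ?thesis using cone_of_zero by simp
  qed
qed

end

theorem theorem2p6:
  fixes \<mu> :: "(real ^ 'n) set \<Rightarrow> real"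
  assumes "CARD('n) \<ge> 2"
    and "cone_valuation \<mu>"
    and "continuous_map cone_topology euclideanreal \<mu>"
    and "orthogonally_invariant \<mu>"
    and "\<And>C. C \<in> closed_convex_cones \<Longrightarrow> dim C < CARD('n) \<or> contains_line C \<Longrightarrow> \<mu> C = 0"
  shows "\<forall>C. simplicial_cone C \<and> pointed_cone C \<longrightarrow> \<mu> C = 0"
proof -
  interpret line_free_valuation \<mu>
    using assms(2-5) by unfold_locales
  show ?thesis using simplicial_zero by blast
qed

end
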